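(* Let $M$ be the manifold of real symmetric positive definite $d\times d$ matrices, regarded as a homogeneous space for $\mathrm{GL}(d)=\mathrm{GL}(d,\mathbf R)$ acting by $A\cdot P=APA^{\top}$, with origin the identity matrix. The space of symmetric matrices $\mathfrak m=\{\xi\in\mathfrak{gl}(d):\xi=\xi^{\top}\}$ is a symmetric reductive structure. The corresponding symmetric connection is defined by $$\langle\omega,\delta P\rangle_P=\tfrac12\,\delta P\,P^{-1}.$$
   Context: For a Lie group $G$ with Lie algebra $\mathfrak g$ acting smoothly and transitively on a manifold $M$ (infinitesimal action $\xi\cdot x\in T_xM$, tangent map $Tg$ of $x\mapsto g\cdot x$, adjoint action $g\cdot\xi=g\xi g^{-1}$), with origin $o\in M$, isotropy group $H$ of $o$ with Lie algebra $\mathfrak h$: - a connection is a $\mathfrak g$-valued one-form $\omega\in\Omega^1(M,\mathfrak g)$ such that $\langle\omega,f\rangle_x\cdot x=f$ for all $x\in M$, $f\in T_xM$, and $\langle\omega,Tg\,f\rangle_{g\cdot x}=g\cdot\langle\omega,f\rangle_x$ for all $g\in G$; - a reductive structure is a subspace $\mathfrak m\subset\mathfrak g$ with $\mathfrak g=\mathfrak h\oplus\mathfrak m$ and $H\cdot\mathfrak m\subset\mathfrak m$; the corresponding connection is the unique one with $\omega(T_oM)=\mathfrak m$; - a reductive structure, or its connection, is symmetric if $[\mathfrak m,\mathfrak m]\subset\mathfrak h$. Here the isotropy group of the identity matrix is $H=\mathrm O(d)$. *)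

theory Defs
  imports "HOL-Analysis.Analysis"
begin

section \<open>Smooth maps and embedded submanifolds of Euclidean spaces\<close>

text \<open>On an open set of a Euclidean space, continuity of all directional derivatives of
  order \<open>\<le> k\<close> of a differentiable map is the same as being of class \<open>C\<^sup>k\<close>.
  The set \<open>U\<close> is always open where this is used.\<close>

primrec Ck_on :: "nat \<Rightarrow> 'a::euclidean_space set \<Rightarrow> ('a \<Rightarrow> 'b::euclidean_space) \<Rightarrow> bool" where
  "Ck_on 0 U f \<longleftrightarrow> continuous_on U f"
| "Ck_on (Suc k) U f \<longleftrightarrow>
     (\<forall>x\<in>U. f differentiable (at x)) \<and> (\<forall>v. Ck_on k U (\<lambda>x. frechet_derivative f (at x) v))"

definition Cinf_on :: "'a::euclidean_space set \<Rightarrow> ('a \<Rightarrow> 'b::euclidean_space) \<Rightarrow> bool" where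
  "Cinf_on U f \<longleftrightarrow> (\<forall>k. Ck_on k U f)"

text \<open>Smoothness on an arbitrary subset (in practice, a submanifold): local existence of
  smooth extensions.\<close>

definition smooth_on :: "'a::euclidean_space set \<Rightarrow> ('a \<Rightarrow> 'b::euclidean_space) \<Rightarrow> bool" where
  "smooth_on S f \<longleftrightarrow>
     (\<forall>x\<in>S. \<exists>U F. open U \<and> x \<in> U \<and> Cinf_on U F \<and> (\<forall>y\<in>U \<inter> S. F y = f y))"

definition embedded_submanifold :: "'a::euclidean_space set \<Rightarrow> bool" where
  "embedded_submanifold M \<longleftrightarrow>
     (\<exists>L. subspace L \<and>
        (\<forall>x\<in>M. \<exists>U V \<phi> \<psi>. open U \<and> x \<in> U \<and> open (V :: 'a set) \<and> homeomorphism U V \<phi> \<psi> \<and>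
           Cinf_on U \<phi> \<and> Cinf_on V \<psi> \<and> \<phi> ` (U \<inter> M) = V \<inter> L))"

definition smooth_curve_at ::
  "'a::euclidean_space set \<Rightarrow> 'a \<Rightarrow> 'a \<Rightarrow> (real \<Rightarrow> 'a) \<Rightarrow> bool" where
  "smooth_curve_at M x v \<gamma> \<longleftrightarrow>
     (\<exists>e>0. Cinf_on {-e<..<e} \<gamma> \<and> \<gamma> ` {-e<..<e} \<subseteq> M) \<and>
     \<gamma> 0 = x \<and> (\<gamma> has_vector_derivative v) (at 0)"

definition tangent_space :: "'a::euclidean_space set \<Rightarrow> 'a \<Rightarrow> 'a set" where
  "tangent_space M x = {v. \<exists>\<gamma>. smooth_curve_at M x v \<gamma>}"

text \<open>The tangent map of \<open>\<phi>\<close>, defined on \<open>M\<close>, at \<open>x\<close> in direction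
  \<open>v \<in> tangent_space M x\<close>; values of \<open>\<phi>\<close> outside \<open>M\<close> are irrelevant.\<close>

definition tangent_map ::
  "'a::euclidean_space set \<Rightarrow> ('a \<Rightarrow> 'b::euclidean_space) \<Rightarrow> 'a \<Rightarrow> 'a \<Rightarrow> 'b" where
  "tangent_map M \<phi> x v =
     (THE w. \<forall>\<gamma>. smooth_curve_at M x v \<gamma> \<longrightarrow> ((\<phi> \<circ> \<gamma>) has_vector_derivative w) (at 0))"

section \<open>Homogeneous spaces of matrix Lie groups\<close>

type_synonym 'n mat = "real ^ 'n ^ 'n"

definition matrix_Lie_group :: "'n::finite mat set \<Rightarrow> bool" where
  "matrix_Lie_group G \<longleftrightarrow>
     embedded_submanifold G \<and> (\<forall>g\<in>G. invertible g) \<and> mat 1 \<in> G \<and>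
     (\<forall>g\<in>G. \<forall>h\<in>G. g ** h \<in> G) \<and> (\<forall>g\<in>G. matrix_inv g \<in> G)"

definition Lie_algebra :: "'n::finite mat set \<Rightarrow> 'n mat set" where
  "Lie_algebra G = tangent_space G (mat 1)"

definition bracket :: "'n::finite mat \<Rightarrow> 'n mat \<Rightarrow> 'n mat" where
  "bracket \<xi> \<eta> = \<xi> ** \<eta> - \<eta> ** \<xi>"

definition Ad :: "'n::finite mat \<Rightarrow> 'n mat \<Rightarrow> 'n mat" where
  "Ad g \<xi> = g ** \<xi> ** matrix_inv g"

definition homogeneous_space ::
  "'n::finite mat set \<Rightarrow> ('n mat \<Rightarrow> 'a::euclidean_space \<Rightarrow> 'a) \<Rightarrow> 'a set \<Rightarrow> bool" where
  "homogeneous_space G act M \<longleftrightarrow>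
     matrix_Lie_group G \<and> embedded_submanifold M \<and> M \<noteq> {} \<and>
     (\<forall>g\<in>G. \<forall>x\<in>M. act g x \<in> M) \<and>
     (\<forall>x\<in>M. act (mat 1) x = x) \<and>
     (\<forall>g\<in>G. \<forall>h\<in>G. \<forall>x\<in>M. act (g ** h) x = act g (act h x)) \<and>
     smooth_on (G \<times> M) (\<lambda>(g, x). act g x) \<and>
     (\<forall>x\<in>M. \<forall>y\<in>M. \<exists>g\<in>G. act g x = y)"

text \<open>The infinitesimal action \<open>\<xi>\<cdot>x\<close>: the derivative at the identity of
  \<open>g \<mapsto> g\<cdot>x\<close> in the direction \<open>\<xi>\<close> of the Lie algebra.\<close>

definition inf_act ::
  "'n::finite mat set \<Rightarrow> ('n mat \<Rightarrow> 'a::euclidean_space \<Rightarrow> 'a) \<Rightarrow> 'n mat \<Rightarrow> 'a \<Rightarrow> 'a" where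
  "inf_act G act \<xi> x = tangent_map G (\<lambda>g. act g x) (mat 1) \<xi>"

definition isotropy ::
  "'n::finite mat set \<Rightarrow> ('n mat \<Rightarrow> 'a::euclidean_space \<Rightarrow> 'a) \<Rightarrow> 'a \<Rightarrow> 'n mat set" where
  "isotropy G act x = {g\<in>G. act g x = x}"

section \<open>Connections and reductive structures\<close>

text \<open>In \<open>\<omega> x v\<close> only base points \<open>x \<in> M\<close> and tangent vectors
  \<open>v \<in> tangent_space M x\<close> are meaningful.  Linearity in \<open>v\<close> and smoothness in
  \<open>x\<close> are both expressed through local extensions \<open>W\<close> to an open set of the
  ambient space; as \<open>W y\<close> is linear on a finite-dimensional space, \<open>W\<close> is smooth
  as soon as \<open>W y v\<close> is smooth in \<open>y\<close> for each fixed \<open>v\<close>.\<close>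

definition smooth_one_form ::
  "'a::euclidean_space set \<Rightarrow> 'b::euclidean_space set \<Rightarrow> ('a \<Rightarrow> 'a \<Rightarrow> 'b) \<Rightarrow> bool" where
  "smooth_one_form M \<gg> \<omega> \<longleftrightarrow>
     (\<forall>x\<in>M. \<forall>v\<in>tangent_space M x. \<omega> x v \<in> \<gg>) \<and>
     (\<forall>x\<in>M. \<exists>U W. open U \<and> x \<in> U \<and> (\<forall>y\<in>U. linear (W y)) \<and> (\<forall>v. Cinf_on U (\<lambda>y. W y v)) \<and>
        (\<forall>y\<in>U \<inter> M. \<forall>v\<in>tangent_space M y. \<omega> y v = W y v))"

definition connection ::
  "'n::finite mat set \<Rightarrow> ('n mat \<Rightarrow> 'a::euclidean_space \<Rightarrow> 'a) \<Rightarrow> 'a set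
     \<Rightarrow> ('a \<Rightarrow> 'a \<Rightarrow> 'n mat) \<Rightarrow> bool" where
  "connection G act M \<omega> \<longleftrightarrow>
     smooth_one_form M (Lie_algebra G) \<omega> \<and>
     (\<forall>x\<in>M. \<forall>f\<in>tangent_space M x. inf_act G act (\<omega> x f) x = f) \<and>
     (\<forall>g\<in>G. \<forall>x\<in>M. \<forall>f\<in>tangent_space M x.
        \<omega> (act g x) (tangent_map M (act g) x f) = Ad g (\<omega> x f))"

definition reductive_structure ::
  "'n::finite mat set \<Rightarrow> ('n mat \<Rightarrow> 'a::euclidean_space \<Rightarrow> 'a) \<Rightarrow> 'a \<Rightarrow> 'n mat set \<Rightarrow> bool" where
  "reductive_structure G act x0 \<mm> \<longleftrightarrow>
     (let \<hh> = Lie_algebra (isotropy G act x0) in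
        subspace \<mm> \<and> \<mm> \<subseteq> Lie_algebra G \<and>
        Lie_algebra G = {\<eta> + \<xi> | \<eta> \<xi>. \<eta> \<in> \<hh> \<and> \<xi> \<in> \<mm>} \<and> \<hh> \<inter> \<mm> = {0} \<and>
        (\<forall>h\<in>isotropy G act x0. \<forall>\<xi>\<in>\<mm>. Ad h \<xi> \<in> \<mm>))"

definition symmetric_reductive_structure ::
  "'n::finite mat set \<Rightarrow> ('n mat \<Rightarrow> 'a::euclidean_space \<Rightarrow> 'a) \<Rightarrow> 'a \<Rightarrow> 'n mat set \<Rightarrow> bool" where
  "symmetric_reductive_structure G act x0 \<mm> \<longleftrightarrow>
     reductive_structure G act x0 \<mm> \<and>
     (\<forall>\<xi>\<in>\<mm>. \<forall>\<eta>\<in>\<mm>. bracket \<xi> \<eta> \<in> Lie_algebra (isotropy G act x0))"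

definition corresponding_connection ::
  "'n::finite mat set \<Rightarrow> ('n mat \<Rightarrow> 'a::euclidean_space \<Rightarrow> 'a) \<Rightarrow> 'a set \<Rightarrow> 'a
     \<Rightarrow> 'n mat set \<Rightarrow> ('a \<Rightarrow> 'a \<Rightarrow> 'n mat) \<Rightarrow> bool" where
  "corresponding_connection G act M x0 \<mm> \<omega> \<longleftrightarrow>
     connection G act M \<omega> \<and> \<omega> x0 ` tangent_space M x0 = \<mm>"

definition symmetric_connection ::
  "'n::finite mat set \<Rightarrow> ('n mat \<Rightarrow> 'a::euclidean_space \<Rightarrow> 'a) \<Rightarrow> 'a set \<Rightarrow> 'a
     \<Rightarrow> ('a \<Rightarrow> 'a \<Rightarrow> 'n mat) \<Rightarrow> bool" where
  "symmetric_connection G act M x0 \<omega> \<longleftrightarrow>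
     connection G act M \<omega> \<and>
     symmetric_reductive_structure G act x0 (\<omega> x0 ` tangent_space M x0)"

section \<open>Symmetric positive definite matrices\<close>

definition GL :: "'n::finite mat set" where
  "GL = {A. invertible A}"

definition spd :: "'n::finite mat set" where
  "spd = {P. transpose P = P \<and> (\<forall>x. x \<noteq> 0 \<longrightarrow> 0 < x \<bullet> (P *v x))}"

definition congr_act :: "'n::finite mat \<Rightarrow> 'n mat \<Rightarrow> 'n mat" where
  "congr_act A P = A ** P ** transpose A"

definition sym_mat :: "'n::finite mat set" where
  "sym_mat = {\<xi>. \<xi> = transpose \<xi>}"

end

theory Submission
  imports Defs
begin

text \<open>At the identity the isotropy algebra consists of the skew matrices (the Cayley transform
  supplies curves in the orthogonal group), so the symmetric matrices form a complement, and the
  commutator of two symmetric matrices is skew.  The infinitesimal action at \<open>P\<close> is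
  \<open>\<xi> P + P \<xi>\<^sup>\<top>\<close>, which returns \<open>\<delta>P\<close> for \<open>\<xi> = \<delta>P P\<^sup>-\<^sup>1 / 2\<close>; at the identity
  this is the only symmetric solution, and equivariance together with transitivity gives
  uniqueness everywhere.\<close>

section \<open>Calculus of \<open>C\<^sup>k\<close> maps\<close>

text \<open>Every map that occurs is built from constants, linear maps, sums, bilinear products and
  the matrix inverse, and \<open>Ck_on\<close> is shown to be closed under exactly these. The
  inverse is the hard case: its derivative is again a product of inverses, so regularity climbs one
  order at a time from mere continuity. This is also why curves in the orthogonal group come from
  the Cayley transform rather than the exponential: it is rational, hence covered by this small
  calculus. \<open>GL\<close> and \<open>spd\<close> are open pieces of linear subspaces, so the
  identity serves as chart and straight lines supply all tangent vectors. Transitivity comes from a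
  basis orthogonal for the form \<open>P\<close>. A connection is a total function with arbitrary
  values off \<open>spd\<close> and off the tangent spaces, so uniqueness means agreement on tangent
  vectors at points of \<open>spd\<close>.\<close>

lemma Ck_on_cong:
  assumes U: "open U" and "\<And>x. x \<in> U \<Longrightarrow> f x = g x" and "Ck_on k U f"
  shows "Ck_on k U g"
  using assms(2-)
proof (induction k arbitrary: f g)
  case 0
  then show ?case using continuous_on_cong[of U U f g] by auto
next
  case (Suc k)
  have D: "(g has_derivative frechet_derivative f (at x)) (at x)" if "x \<in> U" for x
    using has_derivative_transform_within_open[OF _ U that, of f _ UNIV g] Suc.prems that
    by (auto simp: frechet_derivative_works)
  then have "frechet_derivative f (at x) = frechet_derivative g (at x)" if "x \<in> U" for x
    using that by (metis frechet_derivative_at)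
  then have "Ck_on k U (\<lambda>x. frechet_derivative g (at x) v)" for v
    using Suc.IH[of "\<lambda>x. frechet_derivative f (at x) v"] Suc.prems(2) by simp
  then show ?case
    using D by (auto simp: differentiable_def)
qed

text \<open>Replaces the choice operator \<open>frechet_derivative\<close> by any derivative known
  in closed form, so that the closure proofs below can apply their induction hypothesis to an
  explicit formula.\<close>

lemma Ck_on_Suc_iff:
  assumes U: "open U" and D: "\<And>x. x \<in> U \<Longrightarrow> (f has_derivative f' x) (at x)"
  shows "Ck_on (Suc k) U f \<longleftrightarrow> (\<forall>v. Ck_on k U (\<lambda>x. f' x v))"
proof -
  have eq: "frechet_derivative f (at x) = f' x" if "x \<in> U" for x
    using D[OF that] by (metis frechet_derivative_at)
  have "Ck_on k U (\<lambda>x. frechet_derivative f (at x) v) \<longleftrightarrow> Ck_on k U (\<lambda>x. f' x v)" for v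
    using Ck_on_cong[OF U, of "\<lambda>x. frechet_derivative f (at x) v" "\<lambda>x. f' x v" k]
      Ck_on_cong[OF U, of "\<lambda>x. f' x v" "\<lambda>x. frechet_derivative f (at x) v" k] eq
    by metis
  then show ?thesis
    using D by (auto simp: differentiable_def)
qed

lemma Ck_on_Suc_derivative:
  "Ck_on (Suc k) U f \<Longrightarrow> x \<in> U \<Longrightarrow> (f has_derivative frechet_derivative f (at x)) (at x)"
  by (simp add: frechet_derivative_works)

lemma Ck_on_Suc_imp: "Ck_on (Suc k) U f \<Longrightarrow> Ck_on k U f"
proof (induction k arbitrary: f)
  case 0
  then show ?case
    by (auto intro: differentiable_imp_continuous_within continuous_at_imp_continuous_on)
qed auto

lemma Ck_on_subset: "V \<subseteq> U \<Longrightarrow> Ck_on k U f \<Longrightarrow> Ck_on k V f"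
  by (induction k arbitrary: f) (auto intro: continuous_on_subset)

lemma Ck_on_const: "open U \<Longrightarrow> Ck_on k U (\<lambda>x. c)"
  by (induction k arbitrary: c)
    (simp_all add: Ck_on_Suc_iff[OF _ has_derivative_const] del: Ck_on.simps(2))

lemma Ck_on_bounded_linear:
  assumes U: "open U" and L: "bounded_linear L"
  shows "Ck_on k U f \<Longrightarrow> Ck_on k U (\<lambda>x. L (f x))"
proof (induction k arbitrary: f)
  case 0
  then show ?case using bounded_linear.continuous_on[OF L] by simp
next
  case (Suc k)
  show ?case
    by (subst Ck_on_Suc_iff[OF U bounded_linear.has_derivative[OF L Ck_on_Suc_derivative[OF Suc.prems]]])
      (use Suc in auto)
qed

lemma Ck_on_linear:
  assumes "open U" "bounded_linear L"
  shows "Ck_on k U L"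
proof (cases k)
  case 0
  then show ?thesis using assms(2) by (simp add: linear_continuous_on)
next
  case (Suc j)
  show ?thesis unfolding Suc
    by (subst Ck_on_Suc_iff[OF assms(1) bounded_linear_imp_has_derivative[OF assms(2)]])
      (simp add: Ck_on_const assms)
qed

lemma Ck_on_add:
  assumes U: "open U"
  shows "Ck_on k U f \<Longrightarrow> Ck_on k U g \<Longrightarrow> Ck_on k U (\<lambda>x. f x + g x)"
proof (induction k arbitrary: f g)
  case 0
  then show ?case by (simp add: continuous_on_add)
next
  case (Suc k)
  show ?case
    by (subst Ck_on_Suc_iff[OF U has_derivative_add[OF Suc.prems[THEN Ck_on_Suc_derivative]]])
      (use Suc in auto)
qed

text \<open>By the Leibniz rule each term of the derivative keeps one factor undifferentiated. That
  factor is known to be one order smoother than the induction hypothesis asks, which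
  \<open>Ck_on_Suc_imp\<close> corrects.\<close>

lemma Ck_on_bilinear:
  assumes U: "open U" and B: "bounded_bilinear B"
  shows "Ck_on k U f \<Longrightarrow> Ck_on k U g \<Longrightarrow> Ck_on k U (\<lambda>x. B (f x) (g x))"
proof (induction k arbitrary: f g)
  case 0
  then show ?case by (simp add: bounded_bilinear.continuous_on[OF B])
next
  case (Suc k)
  show ?case
    by (subst Ck_on_Suc_iff[OF U bounded_bilinear.FDERIV[OF B Suc.prems[THEN Ck_on_Suc_derivative]]])
      (use Suc Ck_on_Suc_imp[OF Suc.prems(1)] Ck_on_Suc_imp[OF Suc.prems(2)] in \<open>auto intro!: Ck_on_add U\<close>)
qed

lemma Cinf_on_const: "open U \<Longrightarrow> Cinf_on U (\<lambda>x. c)"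
  by (simp add: Cinf_on_def Ck_on_const)

lemma Cinf_on_linear: "open U \<Longrightarrow> bounded_linear L \<Longrightarrow> Cinf_on U L"
  by (simp add: Cinf_on_def Ck_on_linear)

lemma Cinf_on_bounded_linear:
  "open U \<Longrightarrow> bounded_linear L \<Longrightarrow> Cinf_on U f \<Longrightarrow> Cinf_on U (\<lambda>x. L (f x))"
  by (simp add: Cinf_on_def Ck_on_bounded_linear)

lemma Cinf_on_add: "open U \<Longrightarrow> Cinf_on U f \<Longrightarrow> Cinf_on U g \<Longrightarrow> Cinf_on U (\<lambda>x. f x + g x)"
  by (simp add: Cinf_on_def Ck_on_add)

lemma Cinf_on_bilinear:
  "open U \<Longrightarrow> bounded_bilinear B \<Longrightarrow> Cinf_on U f \<Longrightarrow> Cinf_on U g \<Longrightarrow> Cinf_on U (\<lambda>x. B (f x) (g x))"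
  by (simp add: Cinf_on_def Ck_on_bilinear)

section \<open>Smoothness of matrix operations\<close>

lemma bounded_linear_transpose: "bounded_linear (transpose :: real^'n^'m \<Rightarrow> real^'m^'n)"
  by (simp add: linear_conv_bounded_linear[symmetric] linear_iff transpose_def vec_eq_iff)

lemma bounded_bilinear_matrix_mult:
  "bounded_bilinear ((**) :: real^'n^'m \<Rightarrow> real^'p^'n \<Rightarrow> real^'p^'m)"
proof -
  have "bilinear ((**) :: real^'n^'m \<Rightarrow> real^'p^'n \<Rightarrow> real^'p^'m)"
    unfolding bilinear_def linear_iff
    by (auto simp: matrix_add_ldistrib matrix_matrix_mult_def vec_eq_iff algebra_simps sum.distrib sum_distrib_left)
  then show ?thesis by (simp add: bilinear_conv_bounded_bilinear)
qed

lemmas matrix_mult_bilinear_simps =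
  bounded_bilinear.add_left[OF bounded_bilinear_matrix_mult]
  bounded_bilinear.add_right[OF bounded_bilinear_matrix_mult]
  bounded_bilinear.diff_left[OF bounded_bilinear_matrix_mult]
  bounded_bilinear.diff_right[OF bounded_bilinear_matrix_mult]
  bounded_bilinear.minus_left[OF bounded_bilinear_matrix_mult]
  bounded_bilinear.minus_right[OF bounded_bilinear_matrix_mult]
  bounded_bilinear.scaleR_left[OF bounded_bilinear_matrix_mult]
  bounded_bilinear.scaleR_right[OF bounded_bilinear_matrix_mult]
  bounded_bilinear.zero_left[OF bounded_bilinear_matrix_mult]
  bounded_bilinear.zero_right[OF bounded_bilinear_matrix_mult]

lemmas transpose_linear_simps =
  linear_add[OF bounded_linear.linear[OF bounded_linear_transpose]]
  linear_diff[OF bounded_linear.linear[OF bounded_linear_transpose]]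
  linear_neg[OF bounded_linear.linear[OF bounded_linear_transpose]]
  linear_scale[OF bounded_linear.linear[OF bounded_linear_transpose]]

lemma
  fixes A :: "'n::finite mat"
  assumes "invertible A"
  shows matrix_inv_right: "A ** matrix_inv A = mat 1"
    and matrix_inv_left: "matrix_inv A ** A = mat 1"
proof -
  have "A ** matrix_inv A = mat 1 \<and> matrix_inv A ** A = mat 1"
    unfolding matrix_inv_def using assms unfolding invertible_def by (rule someI_ex)
  then show "A ** matrix_inv A = mat 1" "matrix_inv A ** A = mat 1" by auto
qed

lemma matrix_inv_eqI:
  fixes A :: "'n::finite mat"
  assumes "A ** B = mat 1"
  shows "matrix_inv A = B"
proof -
  have "invertible A" using assms by (metis invertible_right_inverse)
  then have "matrix_inv A ** (A ** B) = B" by (simp add: matrix_mul_assoc matrix_inv_left)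
  then show ?thesis by (simp add: assms)
qed

lemma invertible_matrix_inv: "invertible A \<Longrightarrow> invertible (matrix_inv A :: 'n::finite mat)"
  by (metis invertible_def matrix_inv_left matrix_inv_right)

lemma matrix_inv_mult:
  fixes A B :: "'n::finite mat"
  assumes "invertible A" "invertible B"
  shows "matrix_inv (A ** B) = matrix_inv B ** matrix_inv A"
  by (rule matrix_inv_eqI)
    (metis assms matrix_inv_right matrix_mul_assoc matrix_mul_lid)

lemma matrix_inv_transpose:
  fixes A :: "'n::finite mat"
  assumes "invertible A"
  shows "matrix_inv (transpose A) = transpose (matrix_inv A)"
  by (rule matrix_inv_eqI) (metis assms matrix_inv_left matrix_transpose_mul transpose_mat)

lemma invertible_mat_1: "invertible (mat 1 :: 'n::finite mat)"
  by (auto simp: invertible_def)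

lemma matrix_inv_mat_1 [simp]: "matrix_inv (mat 1 :: 'n::finite mat) = mat 1"
  by (rule matrix_inv_eqI) simp

lemma continuous_on_det: "continuous_on S f \<Longrightarrow> continuous_on S (\<lambda>x. det (f x :: 'n::finite mat))"
  unfolding det_def by (intro continuous_intros)

lemma open_GL: "open (GL :: 'n::finite mat set)"
proof -
  have "GL = (det :: 'n mat \<Rightarrow> real) -` (- {0})"
    by (auto simp: GL_def invertible_det_nz)
  then show ?thesis
    using continuous_on_det[OF continuous_on_id, of UNIV]
    by (metis continuous_on_open_vimage open_Compl closed_singleton open_UNIV vimage_UNIV inf_top.right_neutral)
qed

text \<open>Cramer's rule expresses the entries of the inverse through determinants.\<close>

lemma continuous_on_matrix_inv: "continuous_on GL (matrix_inv :: 'n::finite mat \<Rightarrow> 'n mat)"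
proof -
  define C :: "'n mat \<Rightarrow> 'n mat" where
    "C A = (\<chi> k l. det (\<chi> i j. if j = k then (axis l 1 :: real^'n) $ i else A $ i $ j) / det A)" for A
  have "continuous_on GL C"
    unfolding C_def
  proof (intro continuous_on_vec_lambda continuous_on_divide continuous_on_det)
    show "continuous_on GL (\<lambda>A::'n mat. if j = k then (axis l 1 :: real^'n) $ i else A $ i $ j)" for i j k l
      by (cases "j = k") (auto intro!: continuous_intros)
  qed (auto simp: GL_def invertible_det_nz intro!: continuous_intros)
  moreover have "C A = matrix_inv A" if "A \<in> GL" for A
  proof -
    have inv: "invertible A" using that by (simp add: GL_def)
    then have "matrix_inv A *v axis l 1 =
        (\<chi> k. det (\<chi> i j. if j = k then (axis l 1 :: real^'n) $ i else A $ i $ j) / det A)" for l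
      using cramer[of A "matrix_inv A *v axis l 1" "axis l 1"]
      by (simp add: matrix_vector_mul_assoc matrix_inv_right invertible_det_nz)
    then have "matrix_inv A $ k $ l = C A $ k $ l" for k l
      by (metis (no_types, lifting) C_def column_def matrix_vector_mult_basis vec_lambda_beta)
    then show ?thesis by (simp add: vec_eq_iff)
  qed
  ultimately show ?thesis by (metis continuous_on_cong)
qed

text \<open>The resolvent identity turns the first-order remainder into a product of
  \<open>B - A\<close> with the small factor \<open>matrix_inv B - matrix_inv A\<close>. After
  division by \<open>norm (B - A)\<close>, continuity of the inverse is enough.\<close>

lemma has_derivative_matrix_inv:
  fixes A :: "'n::finite mat"
  assumes "invertible A"
  shows "(matrix_inv has_derivative (\<lambda>H. - (matrix_inv A ** H ** matrix_inv A))) (at A)"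
proof -
  have A: "A \<in> GL" using assms by (simp add: GL_def)
  interpret bb: bounded_bilinear "(**) :: 'n mat \<Rightarrow> 'n mat \<Rightarrow> 'n mat" by (rule bounded_bilinear_matrix_mult)
  obtain K where K: "K > 0" "\<And>(X::'n mat) (Y::'n mat). norm (X ** Y) \<le> norm X * norm Y * K"
    using bb.pos_bounded by metis
  obtain e where e: "e > 0" "ball A e \<subseteq> GL"
    using open_GL A open_contains_ball by blast
  let ?I = "matrix_inv :: 'n mat \<Rightarrow> 'n mat"
  show ?thesis
  proof (rule has_derivativeI_sandwich[OF e(1)])
    show "bounded_linear (\<lambda>H. - (?I A ** H ** ?I A))"
      by (intro bounded_linear_minus bb.bounded_linear_left[THEN bounded_linear_compose] bb.bounded_linear_right)
  next
    fix B assume "B \<noteq> A" and "dist B A < e"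
    then have B: "invertible B" using e by (auto simp: GL_def dist_commute subset_iff)
    \<comment> \<open>The resolvent identity; applying it a second time, through the next equation,
      moves the outer \<open>?I B\<close> to \<open>?I A\<close> at the cost of the
      remainder.\<close>
    have "?I B - ?I A + ?I B ** (B - A) ** ?I A = 0"
      by (simp add: bb.diff_left bb.diff_right matrix_inv_left B)
         (simp add: matrix_mul_assoc[symmetric] matrix_inv_right assms)
    moreover have "(?I B - ?I A) ** ((B - A) ** ?I A) = ?I B ** (B - A) ** ?I A - ?I A ** (B - A) ** ?I A"
      unfolding matrix_mul_assoc by (simp only: bb.diff_left)
    ultimately have "?I B - ?I A - - (?I A ** (B - A) ** ?I A) = - ((?I B - ?I A) ** ((B - A) ** ?I A))"
      by (simp add: algebra_simps)
    then have "norm (?I B - ?I A - - (?I A ** (B - A) ** ?I A)) \<le>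
        norm (?I B - ?I A) * (norm (B - A) * norm (?I A) * K) * K"
      by (metis (no_types) norm_minus_cancel
          order_trans[OF K(2) mult_right_mono[OF mult_left_mono[OF K(2) norm_ge_zero] less_imp_le[OF K(1)]]])
    then show "norm (?I B - ?I A - - (?I A ** (B - A) ** ?I A)) / norm (B - A)
        \<le> norm (?I B - ?I A) * (norm (?I A) * K * K)"
      using \<open>B \<noteq> A\<close> by (simp add: field_simps)
  next
    have "isCont ?I A"
      using continuous_on_matrix_inv open_GL A continuous_on_eq_continuous_at by blast
    then have "((\<lambda>B. ?I B - ?I A) \<longlongrightarrow> 0) (at A)"
      by (simp add: isCont_def LIM_zero)
    then show "((\<lambda>B. norm (?I B - ?I A) * (norm (?I A) * K * K)) \<longlongrightarrow> 0) (at A)"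
      by (intro tendsto_mult_left_zero tendsto_norm_zero)
  qed
qed

text \<open>A bootstrap: the derivative of the inverse is a product of the inverse, a derivative of
  \<open>f\<close> and the inverse again, so order \<open>k\<close> for the inverse yields order
  \<open>k + 1\<close>.\<close>

lemma Cinf_on_matrix_inv:
  fixes f :: "'a::euclidean_space \<Rightarrow> 'n::finite mat"
  assumes U: "open U" and f: "Cinf_on U f" and inv: "\<And>x. x \<in> U \<Longrightarrow> invertible (f x)"
  shows "Cinf_on U (\<lambda>x. matrix_inv (f x))"
  unfolding Cinf_on_def
proof
  fix k show "Ck_on k U (\<lambda>x. matrix_inv (f x))"
  proof (induction k)
    case 0
    have "continuous_on U f" using f by (metis Ck_on.simps(1) Cinf_on_def)
    then show ?case
      using continuous_on_compose2[OF continuous_on_matrix_inv] inv by (auto simp: GL_def)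
  next
    case (Suc k)
    have fS: "Ck_on (Suc k) U f" using f by (simp add: Cinf_on_def del: Ck_on.simps)
    have D: "((\<lambda>x. matrix_inv (f x)) has_derivative
       (\<lambda>v. - (matrix_inv (f x) ** frechet_derivative f (at x) v ** matrix_inv (f x)))) (at x)"
      if "x \<in> U" for x
      using has_derivative_compose[OF Ck_on_Suc_derivative[OF fS that] has_derivative_matrix_inv[OF inv[OF that]]] .
    show ?case
      using fS Suc
      by (subst Ck_on_Suc_iff[OF U D])
        (auto intro!: Ck_on_bounded_linear[where L = uminus] bounded_linear_minus bounded_linear_ident
          Ck_on_bilinear[OF U bounded_bilinear_matrix_mult] U)
  qed
qed

section \<open>Submanifolds and tangent maps\<close>

text \<open>The identity of \<open>U\<close> is a chart that straightens \<open>M\<close> onto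
  \<open>L\<close>. Both manifolds are of this kind, with \<open>L\<close> equal to
  \<open>UNIV\<close> for \<open>GL\<close> and to \<open>sym_mat\<close> for
  \<open>spd\<close>.\<close>

lemma embedded_submanifoldI:
  fixes M :: "'a::euclidean_space set"
  assumes "open U" "M = U \<inter> L" "subspace L"
  shows "embedded_submanifold M"
  unfolding embedded_submanifold_def
proof (intro exI conjI ballI)
  show "subspace L" by fact
  show "open U" "open U" by fact+
  show "homeomorphism U U (\<lambda>x. x) (\<lambda>x. x)" by (simp add: homeomorphism_def)
  show "Cinf_on U (\<lambda>x. x)" "Cinf_on U (\<lambda>x. x)" by (simp_all add: Cinf_on_linear \<open>open U\<close> bounded_linear_ident)
  show "(\<lambda>x. x) ` (U \<inter> M) = U \<inter> L" using assms(2) by auto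
  show "x \<in> U" if "x \<in> M" for x using that assms(2) by auto
qed

lemma smooth_curve_at_line:
  fixes M :: "'a::euclidean_space set"
  assumes U: "open U" "x \<in> U" "U \<inter> L \<subseteq> M" and L: "subspace L" "x \<in> L" "v \<in> L"
  shows "smooth_curve_at M x v (\<lambda>t. x + t *\<^sub>R v)"
  unfolding smooth_curve_at_def
proof (intro conjI)
  have "open ((\<lambda>t. x + t *\<^sub>R v) -` U)"
    by (intro open_vimage U) (intro continuous_intros)
  moreover have "0 \<in> (\<lambda>t. x + t *\<^sub>R v) -` U" using U by simp
  ultimately obtain e where e: "e > 0" "ball 0 e \<subseteq> (\<lambda>t. x + t *\<^sub>R v) -` U"
    using open_contains_ball by blast
  have "x + t *\<^sub>R v \<in> M" if "t \<in> {-e<..<e}" for t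
    using e that U(3) L by (auto simp: subset_iff dist_real_def subspace_add subspace_scale)
  then show "\<exists>e>0. Cinf_on {-e<..<e} (\<lambda>t. x + t *\<^sub>R v) \<and> (\<lambda>t. x + t *\<^sub>R v) ` {-e<..<e} \<subseteq> M"
    using e(1) by (intro exI[of _ e]) (auto intro!: Cinf_on_add[OF _ Cinf_on_const Cinf_on_linear] bounded_linear_scaleR_left)
  show "((\<lambda>t. x + t *\<^sub>R v) has_vector_derivative v) (at 0)"
    by (auto intro!: derivative_eq_intros)
qed simp

lemma smooth_curve_at_open:
  assumes "open M" "x \<in> M"
  shows "smooth_curve_at M x v (\<lambda>t. x + t *\<^sub>R v)"
  by (rule smooth_curve_at_line[of M x UNIV]) (auto simp: assms)

lemma tangent_space_open: "open M \<Longrightarrow> x \<in> M \<Longrightarrow> tangent_space M x = UNIV"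
  using smooth_curve_at_open by (fastforce simp: tangent_space_def)

text \<open>The description in \<open>tangent_map\<close> quantifies over curves and would be
  vacuous without one. The tangency of \<open>v\<close> provides a curve, and uniqueness of its
  derivative pins down \<open>w\<close>.\<close>

lemma tangent_map_eqI:
  assumes "v \<in> tangent_space M x"
    and "\<And>\<gamma>. smooth_curve_at M x v \<gamma> \<Longrightarrow> ((\<phi> \<circ> \<gamma>) has_vector_derivative w) (at 0)"
  shows "tangent_map M \<phi> x v = w"
proof -
  obtain \<gamma> where "smooth_curve_at M x v \<gamma>" using assms(1) by (auto simp: tangent_space_def)
  then show ?thesis
    unfolding tangent_map_def
    by (intro the_equality) (use assms(2) vector_derivative_unique_at in blast)+
qed

text \<open>Along the curve \<open>L\<close> is constant, so its derivative vanishes. Applied to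
  transposition minus the identity, this makes tangent vectors of \<open>spd\<close>
  symmetric.\<close>

lemma smooth_curve_at_linear_eq:
  assumes \<gamma>: "smooth_curve_at M x v \<gamma>" and L: "bounded_linear L" and M: "\<And>y. y \<in> M \<Longrightarrow> L y = c"
  shows "L v = 0"
proof -
  obtain e where e: "e > 0" "\<gamma> ` {-e<..<e} \<subseteq> M" and D: "(\<gamma> has_vector_derivative v) (at 0)"
    using \<gamma> by (auto simp: smooth_curve_at_def)
  have "((\<lambda>t. L (\<gamma> t)) has_vector_derivative L v) (at 0)"
    by (rule bounded_linear.has_vector_derivative[OF L D])
  moreover have "((\<lambda>t. L (\<gamma> t)) has_vector_derivative 0) (at 0)"
    by (rule has_vector_derivative_transform_within_open[of "\<lambda>t. c" _ _ "{-e<..<e}"])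
      (use e M in \<open>auto intro!: derivative_eq_intros simp: image_subset_iff\<close>)
  ultimately show ?thesis by (rule vector_derivative_unique_at)
qed

section \<open>Symmetric positive definite matrices\<close>

lemma subspace_sym_mat: "subspace (sym_mat :: 'n::finite mat set)"
  unfolding subspace_def sym_mat_def
  by (simp add: transpose_linear_simps) (simp add: transpose_def vec_eq_iff)

text \<open>Positivity is separated from symmetry because it is an open condition in the full matrix
  space; symmetry then cuts out a linear subspace.\<close>

definition pos_mat :: "'n::finite mat set" where
  "pos_mat = {P. \<forall>x. x \<noteq> 0 \<longrightarrow> 0 < x \<bullet> (P *v x)}"

lemma spd_eq: "spd = pos_mat \<inter> sym_mat"
  by (auto simp: spd_def pos_mat_def sym_mat_def)

text \<open>On the compact unit sphere the form of \<open>P\<close> has a minimum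
  \<open>c > 0\<close>. A perturbation of norm below \<open>c / K\<close> changes the form there by
  less than \<open>c\<close>, and homogeneity extends positivity to all nonzero vectors.\<close>

lemma open_pos_mat: "open (pos_mat :: 'n::finite mat set)"
proof -
  have "bilinear (\<lambda>(P::'n mat) x. P *v x)"
    unfolding bilinear_def linear_iff
    by (auto simp: matrix_vector_mult_def vec_eq_iff algebra_simps sum.distrib sum_distrib_left)
  then have "bounded_bilinear (\<lambda>(P::'n mat) x. P *v x)"
    by (simp add: bilinear_conv_bounded_bilinear)
  then obtain K where K: "K > 0" "\<And>(P::'n mat) (x::real^'n). norm (P *v x) \<le> norm P * norm x * K"
    using bounded_bilinear.pos_bounded by metis
  show ?thesis
    unfolding open_dist
  proof
    fix P :: "'n mat" assume P: "P \<in> pos_mat"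
    let ?S = "sphere (0::real^'n) 1"
    have "?S \<noteq> {}" by simp
    moreover have "continuous_on ?S (\<lambda>x. x \<bullet> (P *v x))"
      by (intro continuous_on_inner continuous_on_id matrix_vector_mult_linear_continuous_on)
    ultimately obtain x0 where x0: "x0 \<in> ?S" "\<And>x. x \<in> ?S \<Longrightarrow> x0 \<bullet> (P *v x0) \<le> x \<bullet> (P *v x)"
      using continuous_attains_inf[OF compact_sphere, of "0::real^'n" 1 "\<lambda>x. x \<bullet> (P *v x)"] by auto
    define c where "c = x0 \<bullet> (P *v x0)"
    have "x0 \<noteq> 0" using x0(1) by auto
    then have c: "c > 0" using P by (auto simp: c_def pos_mat_def)
    have "Q \<in> pos_mat" if "dist Q P < c / K" for Q
      unfolding pos_mat_def
    proof safe
      fix x :: "real^'n" assume x: "x \<noteq> 0"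
      define u where "u = x /\<^sub>R norm x"
      have u: "norm u = 1" "x = norm x *\<^sub>R u" using x by (simp_all add: u_def)
      have "norm ((Q - P) *v u) < c"
        using K(2)[of "Q - P" u] that K(1) u(1) by (simp add: dist_norm field_simps)
      then have "- (u \<bullet> ((Q - P) *v u)) < c"
        using norm_cauchy_schwarz[of "- u" "(Q - P) *v u"] u(1) by simp
      then have "0 < u \<bullet> (Q *v u)"
        using x0(2)[of u] u(1) by (simp add: c_def matrix_vector_mult_diff_rdistrib inner_diff_right)
      moreover have "x \<bullet> (Q *v x) = (norm x)\<^sup>2 * (u \<bullet> (Q *v u))"
        by (subst (1 2) u(2)) (simp add: matrix_vector_mult_scaleR power2_eq_square)
      ultimately show "0 < x \<bullet> (Q *v x)" using x by simp
    qed
    then show "\<exists>e>0. \<forall>Q. dist Q P < e \<longrightarrow> Q \<in> pos_mat"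
      using c K(1) by (intro exI[of _ "c / K"]) auto
  qed
qed

lemma mat_1_in_spd: "mat 1 \<in> (spd :: 'n::finite mat set)"
  by (simp add: spd_def)

lemma spd_sym: "P \<in> spd \<Longrightarrow> transpose P = P"
  by (simp add: spd_def)

lemma spd_invertible: "P \<in> spd \<Longrightarrow> invertible (P :: 'n::finite mat)"
  by (metis (mono_tags, lifting) spd_def invertible_left_inverse inner_zero_right less_irrefl
      matrix_left_invertible_ker mem_Collect_eq)

lemma tangent_space_spd:
  assumes P: "P \<in> (spd :: 'n::finite mat set)"
  shows "tangent_space spd P = sym_mat"
proof
  show "tangent_space spd P \<subseteq> sym_mat"
  proof
    fix v assume "v \<in> tangent_space spd P"
    then obtain \<gamma> where "smooth_curve_at spd P v \<gamma>" by (auto simp: tangent_space_def)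
    then have "transpose v - v = 0"
      by (rule smooth_curve_at_linear_eq[where c = 0])
        (auto intro!: bounded_linear_sub bounded_linear_transpose bounded_linear_ident simp: spd_sym)
    then show "v \<in> sym_mat" by (simp add: sym_mat_def)
  qed
  show "sym_mat \<subseteq> tangent_space spd P"
    using P smooth_curve_at_line[OF open_pos_mat, of P sym_mat spd]
    by (fastforce simp: tangent_space_def spd_eq subspace_sym_mat)
qed

lemma tangent_map_linear:
  assumes "v \<in> tangent_space M x" and L: "bounded_linear L"
  shows "tangent_map M L x v = L v"
  using assms(1)
  by (rule tangent_map_eqI)
    (auto simp: smooth_curve_at_def o_def intro: bounded_linear.has_vector_derivative[OF L])

section \<open>The congruence action and its transitivity\<close>

lemma bounded_linear_congr_act: "bounded_linear (congr_act (A :: 'n::finite mat))"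
  unfolding congr_act_def[abs_def]
  by (intro bounded_linear_compose[OF bounded_bilinear.bounded_linear_left[OF bounded_bilinear_matrix_mult]]
      bounded_bilinear.bounded_linear_right[OF bounded_bilinear_matrix_mult])

lemma congr_act_mult: "congr_act (A ** B) P = congr_act A (congr_act B P)"
  by (simp add: congr_act_def matrix_transpose_mul matrix_mul_assoc)

lemma congr_act_mat_1 [simp]: "congr_act (mat 1) P = P"
  by (simp add: congr_act_def)

lemma congr_act_inv_cancel:
  assumes "A \<in> GL"
  shows "congr_act (matrix_inv A) (congr_act A P) = P" "congr_act A (congr_act (matrix_inv A) P) = P"
  using assms by (simp_all flip: congr_act_mult add: GL_def matrix_inv_left matrix_inv_right)

lemma congr_act_sym: "P \<in> sym_mat \<Longrightarrow> congr_act A P \<in> sym_mat"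
  by (simp add: congr_act_def sym_mat_def matrix_transpose_mul matrix_mul_assoc)

lemma congr_act_spd:
  assumes A: "A \<in> GL" and P: "P \<in> spd"
  shows "congr_act A P \<in> spd"
proof -
  have "0 < x \<bullet> (congr_act A P *v x)" if "x \<noteq> 0" for x
  proof -
    have "transpose A *v x \<noteq> 0"
      using A that transpose_invertible[of A] matrix_left_invertible_ker[of "transpose A"]
      by (auto simp: GL_def invertible_left_inverse)
    moreover have "x \<bullet> (congr_act A P *v x) = (transpose A *v x) \<bullet> (P *v (transpose A *v x))"
      by (simp add: congr_act_def dot_lmul_matrix matrix_vector_mul_assoc[symmetric])
    ultimately show ?thesis using P by (simp add: spd_def)
  qed
  then show ?thesis
    using congr_act_sym[of P A] P by (auto simp: spd_eq pos_mat_def)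
qed

text \<open>A set of nonzero vectors that is orthogonal with respect to the form \<open>P\<close> and of
  maximal cardinality is a basis; after normalisation it gives the rows of \<open>A\<close>.\<close>

lemma spd_congr_act_eq_mat_1:
  assumes P: "P \<in> (spd :: 'n::finite mat set)"
  obtains A where "A \<in> GL" "congr_act A P = mat 1"
proof -
  let ?B = "\<lambda>v w. v \<bullet> (P *v w)"
  have sym: "?B v w = ?B w v" for v w
    using spd_sym[OF P] by (metis dot_lmul_matrix inner_commute vector_transpose_matrix)
  have pos: "0 < ?B v v" if "v \<noteq> 0" for v
    using P that by (simp add: spd_def)
  define Q where "Q S \<longleftrightarrow> 0 \<notin> S \<and> (\<forall>v\<in>S. \<forall>w\<in>S. v \<noteq> w \<longrightarrow> ?B v w = 0)" for S
  have indep: "independent S" if "Q S" for S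
  proof -
    have "v \<notin> span (S - {v})" if v: "v \<in> S" for v
    proof
      assume "v \<in> span (S - {v})"
      \<comment> \<open>The vector \<open>P *v v\<close> is Euclidean-orthogonal to all other
        members of \<open>S\<close>, hence to their span.\<close>
      then have "?B v v = 0"
        using orthogonal_to_span[of v "S - {v}" "P *v v"] v \<open>Q S\<close> sym
        by (auto simp: Q_def orthogonal_def inner_commute)
      then show False using pos[of v] \<open>Q S\<close> v by (auto simp: Q_def)
    qed
    then show ?thesis by (auto simp: dependent_def)
  qed
  have bound: "finite S \<and> card S \<le> CARD('n)" if "Q S" for S
    using indep[OF that] independent_bound by fastforce
  have "Q {}" by (simp add: Q_def)
  then obtain S where S: "Q S" and max: "\<And>T. Q T \<Longrightarrow> card T \<le> card S"
    using ex_has_greatest_nat[of Q "{}" card "Suc CARD('n)"] bound by (metis less_Suc_eq_le)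
  have "card S = CARD('n)"
  proof (rule ccontr)
    assume "card S \<noteq> CARD('n)"
    then have "card S < CARD('n)" using bound[OF S] by simp
    \<comment> \<open>Euclidean orthogonality to \<open>P *v v\<close> is
      \<open>P\<close>-orthogonality to \<open>v\<close>. Too few such images leave room for a
      nonzero \<open>x\<close> orthogonal to them all, which would enlarge the maximal
      \<open>S\<close>.\<close>
    then have "dim ((*v) P ` S) < DIM(real^'n)"
      using dim_le_card'[of "(*v) P ` S"] card_image_le[of S "(*v) P"] bound[OF S] by simp
    then obtain x where x: "x \<noteq> 0" "\<And>y. y \<in> span ((*v) P ` S) \<Longrightarrow> orthogonal x y"
      using orthogonal_to_subspace_exists by blast
    then have "?B x v = 0" if "v \<in> S" for v
      using that by (auto simp: orthogonal_def span_base)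
    then have "Q (insert x S)" "x \<notin> S"
      using S x(1) sym pos[of x] by (auto simp: Q_def)
    then show False using max[of "insert x S"] bound[OF S] by simp
  qed
  then obtain f where f: "bij_betw f (UNIV :: 'n set) S"
    using bound[OF S] by (metis finite finite_same_card_bij)
  define A :: "'n mat" where "A = (\<chi> i. f i /\<^sub>R sqrt (?B (f i) (f i)))"
  have fS: "f i \<in> S" "f i \<noteq> 0" for i
    using f S by (auto simp: bij_betw_def Q_def)
  have ff: "0 < ?B (f i) (f i)" for i
    by (rule pos[OF fS(2)])
  have f0: "?B (f i) (f j) = 0" if "i \<noteq> j" for i j
  proof -
    have "f i \<noteq> f j" using f that by (auto simp: bij_betw_def inj_eq)
    then show ?thesis using S fS(1) by (simp add: Q_def)
  qed
  have "(A ** P ** transpose A) $ i $ j = A $ i \<bullet> (P *v (A $ j))" for i j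
    by (simp add: matrix_matrix_mult_def transpose_def matrix_vector_mult_def inner_vec_def
        sum_distrib_left sum_distrib_right mult.assoc) (subst sum.swap, simp add: mult_ac)
  moreover have "A $ i \<bullet> (P *v (A $ j)) = mat 1 $ i $ j" for i j
    using ff[of i] f0[of i j] by (cases "i = j") (simp_all add: A_def mat_def matrix_vector_mult_scaleR
        less_imp_le flip: mult.assoc inverse_mult_distrib)
  ultimately have 1: "congr_act A P = mat 1"
    by (simp add: congr_act_def vec_eq_iff)
  moreover have "A \<in> GL"
    using 1 unfolding GL_def congr_act_def by (metis invertible_right_inverse matrix_mul_assoc mem_Collect_eq)
  ultimately show ?thesis using that by blast
qed

lemma spd_eq_congr_act_mat_1:
  assumes P: "P \<in> (spd :: 'n::finite mat set)"
  obtains A where "A \<in> GL" "congr_act A (mat 1) = P"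
  using spd_congr_act_eq_mat_1[OF P] congr_act_inv_cancel(1) invertible_matrix_inv
  by (metis GL_def mem_Collect_eq)

section \<open>The homogeneous space and its symmetric connection\<close>

lemma matrix_Lie_group_GL: "matrix_Lie_group (GL :: 'n::finite mat set)"
  unfolding matrix_Lie_group_def
  using embedded_submanifoldI[OF open_GL, of GL UNIV]
  by (auto simp: GL_def invertible_mult invertible_matrix_inv intro: invertible_mat_1)

lemma homogeneous_space_spd:
  "homogeneous_space (GL :: 'n::finite mat set) congr_act (spd :: 'n mat set)"
  unfolding homogeneous_space_def
proof (intro conjI ballI)
  show "matrix_Lie_group (GL :: 'n mat set)" by (rule matrix_Lie_group_GL)
  show "embedded_submanifold (spd :: 'n mat set)"
    by (rule embedded_submanifoldI[OF open_pos_mat spd_eq subspace_sym_mat])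
  show "(spd :: 'n mat set) \<noteq> {}" using mat_1_in_spd by blast
  show "congr_act A P \<in> spd" if "A \<in> GL" "P \<in> spd" for A P :: "'n mat"
    using that by (rule congr_act_spd)
  show "congr_act (mat 1) P = P" for P :: "'n mat" by simp
  show "congr_act (A ** B) P = congr_act A (congr_act B P)" for A B P :: "'n mat"
    by (rule congr_act_mult)
  \<comment> \<open>The action is polynomial in both arguments, so one extension to all pairs of
    matrices works at every point.\<close>
  have "Cinf_on UNIV (\<lambda>p :: 'n mat \<times> 'n mat. fst p ** snd p ** transpose (fst p))"
    by (intro Cinf_on_bilinear[OF _ bounded_bilinear_matrix_mult] Cinf_on_bounded_linear[OF _ bounded_linear_transpose]
        Cinf_on_linear open_UNIV bounded_linear_fst bounded_linear_snd)
  then show "smooth_on (GL \<times> spd) (\<lambda>(A, P). congr_act A P :: 'n mat)"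
    unfolding smooth_on_def
    by (intro ballI exI[of _ UNIV] exI[of _ "\<lambda>p. fst p ** snd p ** transpose (fst p)"])
      (auto simp: congr_act_def)
next
  fix P Q :: "'n mat" assume P: "P \<in> spd" and "Q \<in> spd"
  then obtain A B where A: "A \<in> GL" "congr_act A P = mat 1" and B: "B \<in> GL" "congr_act B (mat 1) = Q"
    using spd_congr_act_eq_mat_1 spd_eq_congr_act_mat_1 by metis
  \<comment> \<open>Any two points are joined by passing through the identity matrix.\<close>
  then have "congr_act (B ** A) P = Q" by (simp add: congr_act_mult)
  moreover have "B ** A \<in> GL" using A B by (simp add: GL_def invertible_mult)
  ultimately show "\<exists>A\<in>GL. congr_act A P = Q" by blast
qed

section \<open>The isotropy group and its Lie algebra\<close>

lemma isotropy_mat_1: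
  "isotropy GL congr_act (mat 1) = {A :: 'n::finite mat. orthogonal_matrix A}"
proof (intro set_eqI iffI)
  fix A :: "'n mat" assume "A \<in> isotropy GL congr_act (mat 1)"
  then have "A ** transpose A = mat 1" by (simp add: isotropy_def congr_act_def)
  then show "A \<in> {A. orthogonal_matrix A}"
    using matrix_left_right_inverse by (auto simp: orthogonal_matrix_def)
next
  fix A :: "'n mat" assume "A \<in> {A. orthogonal_matrix A}"
  then show "A \<in> isotropy GL congr_act (mat 1)"
    by (auto simp: isotropy_def congr_act_def GL_def orthogonal_matrix_def invertible_def)
qed

lemma Lie_algebra_GL: "Lie_algebra GL = (UNIV :: 'n::finite mat set)"
  unfolding Lie_algebra_def
  by (rule tangent_space_open[OF open_GL]) (simp add: GL_def invertible_mat_1)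

text \<open>The quadratic form of a skew matrix vanishes, so
  \<open>x \<bullet> ((mat 1 + S) *v x)\<close> is the squared norm of \<open>x\<close> and the
  kernel is trivial.\<close>

lemma skew_invertible:
  fixes S :: "'n::finite mat"
  assumes S: "transpose S = - S"
  shows "invertible (mat 1 + S)"
proof -
  have "x = 0" if x: "(mat 1 + S) *v x = 0" for x
  proof -
    have "x \<bullet> (S *v x) = x \<bullet> (transpose S *v x)"
      by (metis dot_lmul_matrix inner_commute transpose_matrix_vector)
    also have "\<dots> = - (x \<bullet> (S *v x))"
      using S matrix_vector_mult_diff_rdistrib[of 0 S x] by simp
    finally have "x \<bullet> (S *v x) = 0" by simp
    moreover have "x \<bullet> ((mat 1 + S) *v x) = 0" using x by simp
    ultimately show "x = 0" by (simp add: matrix_vector_mult_add_rdistrib inner_add_right)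
  qed
  then show ?thesis
    by (metis invertible_left_inverse matrix_left_invertible_ker)
qed

text \<open>To first order at \<open>S = 0\<close> this is \<open>mat 1 + 2 *\<^sub>R S\<close>, so
  a curve with velocity \<open>\<xi>\<close> has to be fed half of
  \<open>t *\<^sub>R \<xi>\<close>.\<close>

definition cayley :: "'n::finite mat \<Rightarrow> 'n mat" where
  "cayley S = matrix_inv (mat 1 - S) ** (mat 1 + S)"

text \<open>Transposition exchanges \<open>mat 1 + S\<close> and \<open>mat 1 - S\<close>. As these
  commute, the product with the transpose telescopes to the identity.\<close>

lemma orthogonal_cayley:
  fixes S :: "'n::finite mat"
  assumes S: "transpose S = - S"
  shows "orthogonal_matrix (cayley S)"
proof -
  let ?P = "mat 1 + S" and ?M = "mat 1 - S"
  have P: "invertible ?P" using S by (rule skew_invertible)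
  have M: "invertible ?M" using skew_invertible[of "- S"] S by (simp add: transpose_linear_simps)
  have comm: "?P ** ?M = ?M ** ?P" by (simp add: matrix_mult_bilinear_simps)
  have "transpose (cayley S) = ?M ** matrix_inv ?P"
    using M S by (simp add: cayley_def matrix_transpose_mul matrix_inv_transpose[symmetric] transpose_linear_simps)
  then have "cayley S ** transpose (cayley S) = matrix_inv ?M ** (?P ** ?M) ** matrix_inv ?P"
    by (simp add: cayley_def matrix_mul_assoc)
  also have "\<dots> = (matrix_inv ?M ** ?M) ** (?P ** matrix_inv ?P)"
    by (simp only: comm matrix_mul_assoc)
  also have "\<dots> = mat 1" by (simp add: matrix_inv_left[OF M] matrix_inv_right[OF P])
  finally show ?thesis
    using matrix_left_right_inverse by (auto simp: orthogonal_matrix_def)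
qed

lemma Lie_algebra_orthogonal:
  "Lie_algebra {A :: 'n::finite mat. orthogonal_matrix A} = {\<xi>. transpose \<xi> = - \<xi>}"
proof (intro set_eqI iffI)
  fix \<xi> :: "'n mat" assume "\<xi> \<in> Lie_algebra {A. orthogonal_matrix A}"
  then obtain \<gamma> e where e: "e > 0" "\<gamma> ` {-e<..<e} \<subseteq> {A :: 'n mat. orthogonal_matrix A}"
    and \<gamma>: "\<gamma> 0 = mat 1" "(\<gamma> has_vector_derivative \<xi>) (at 0)"
    by (auto simp: Lie_algebra_def tangent_space_def smooth_curve_at_def)
  \<comment> \<open>Differentiates the relation
    \<open>\<gamma> t ** transpose (\<gamma> t) = mat 1\<close>, valid for \<open>t\<close> near 0,
    in two ways.\<close>
  have "((\<lambda>t. \<gamma> t ** transpose (\<gamma> t)) has_vector_derivative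
      \<gamma> 0 ** transpose \<xi> + \<xi> ** transpose (\<gamma> 0)) (at 0)"
    by (intro bounded_bilinear.has_vector_derivative[OF bounded_bilinear_matrix_mult]
        bounded_linear.has_vector_derivative[OF bounded_linear_transpose] \<gamma>)
  moreover have "((\<lambda>t. \<gamma> t ** transpose (\<gamma> t)) has_vector_derivative 0) (at 0)"
    by (rule has_vector_derivative_transform_within_open[of "\<lambda>t. mat 1" _ _ "{-e<..<e}"])
      (use e in \<open>auto simp: orthogonal_matrix_def image_subset_iff\<close>)
  ultimately have "\<gamma> 0 ** transpose \<xi> + \<xi> ** transpose (\<gamma> 0) = 0"
    by (rule vector_derivative_unique_at)
  then show "\<xi> \<in> {\<xi>. transpose \<xi> = - \<xi>}" by (simp add: \<gamma> eq_neg_iff_add_eq_0)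
next
  fix \<xi> :: "'n mat" assume "\<xi> \<in> {\<xi>. transpose \<xi> = - \<xi>}"
  then have skew: "transpose (t *\<^sub>R \<xi>) = - (t *\<^sub>R \<xi>)" for t by (simp add: transpose_scalar)
  define \<gamma> where "\<gamma> t = cayley ((t / 2) *\<^sub>R \<xi>)" for t :: real
  have inv: "invertible (mat 1 + t *\<^sub>R \<xi>)" for t by (rule skew_invertible[OF skew])
  have lin: "Cinf_on UNIV (\<lambda>t. mat 1 + (a * t) *\<^sub>R \<xi>)" for a :: real
    by (intro Cinf_on_add[OF _ Cinf_on_const Cinf_on_linear] open_UNIV
        bounded_linear_compose[OF bounded_linear_scaleR_left bounded_linear_mult_right])
  have \<gamma>_eq: "\<gamma> = (\<lambda>t. matrix_inv (mat 1 + (- (1/2) * t) *\<^sub>R \<xi>) ** (mat 1 + (1/2 * t) *\<^sub>R \<xi>))"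
    by (simp add: \<gamma>_def cayley_def fun_eq_iff)
  have "Cinf_on UNIV \<gamma>"
    unfolding \<gamma>_eq
    by (intro Cinf_on_bilinear[OF _ bounded_bilinear_matrix_mult] Cinf_on_matrix_inv lin open_UNIV inv)
  \<comment> \<open>The curve is smooth and orthogonal for every real \<open>t\<close>; the radius 1
    is an arbitrary choice.\<close>
  then have "Cinf_on {-1<..<1} \<gamma>"
    by (auto simp: Cinf_on_def intro: Ck_on_subset[of _ UNIV])
  moreover have "(\<gamma> has_vector_derivative \<xi>) (at 0)"
  proof -
    have D: "((\<lambda>t. mat 1 + (a * t) *\<^sub>R \<xi>) has_derivative (\<lambda>h. (a * h) *\<^sub>R \<xi>)) (at 0)" for a :: real
      by (auto intro!: derivative_eq_intros)
    \<comment> \<open>Each of the two factors of the curve equals \<open>mat 1\<close> at 0 and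
      contributes velocity \<open>\<xi> / 2\<close>; the minus sign of the inverse cancels that of
      \<open>- (1/2)\<close>.\<close>
    have "((\<lambda>t. matrix_inv (mat 1 + (- (1/2) * t) *\<^sub>R \<xi>)) has_derivative
        (\<lambda>h. - (mat 1 ** ((- (1/2) * h) *\<^sub>R \<xi>) ** mat 1))) (at 0)"
      using has_derivative_compose[OF D[of "- (1/2)"] has_derivative_matrix_inv[OF inv]] by simp
    from bounded_bilinear.FDERIV[OF bounded_bilinear_matrix_mult this D[of "1/2"]]
    show ?thesis
      unfolding has_vector_derivative_def \<gamma>_eq by (simp flip: scaleR_add_left)
  qed
  moreover have "\<gamma> t \<in> {A. orthogonal_matrix A}" for t
    by (simp add: \<gamma>_def orthogonal_cayley[OF skew])
  moreover have "\<gamma> 0 = mat 1" by (simp add: \<gamma>_def cayley_def)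
  ultimately have "smooth_curve_at {A. orthogonal_matrix A} (mat 1) \<xi> \<gamma>"
    unfolding smooth_curve_at_def by (intro conjI exI[of _ 1]) auto
  then show "\<xi> \<in> Lie_algebra {A. orthogonal_matrix A}"
    by (auto simp: Lie_algebra_def tangent_space_def)
qed

lemma symmetric_reductive_structure_sym_mat:
  "symmetric_reductive_structure GL congr_act (mat 1) (sym_mat :: 'n::finite mat set)"
proof -
  have "\<exists>\<eta> \<zeta>. \<xi> = \<eta> + \<zeta> \<and> transpose \<eta> = - \<eta> \<and> \<zeta> \<in> sym_mat" for \<xi> :: "'n mat"
  proof (intro exI conjI)
    show "\<xi> = (1/2) *\<^sub>R (\<xi> - transpose \<xi>) + (1/2) *\<^sub>R (\<xi> + transpose \<xi>)"
      by (simp add: algebra_simps flip: scaleR_add_left)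
  qed (simp_all add: sym_mat_def transpose_linear_simps algebra_simps)
  moreover have "{\<xi> :: 'n mat. transpose \<xi> = - \<xi>} \<inter> sym_mat = {0}"
  proof -
    have "\<xi> = 0" if "\<xi> = - \<xi>" for \<xi> :: "'n mat"
      using that by (simp add: vec_eq_iff)
    moreover have "transpose (0 :: 'n mat) = 0" by (simp add: transpose_def vec_eq_iff)
    ultimately show ?thesis by (auto simp: sym_mat_def)
  qed
  \<comment> \<open>For orthogonal \<open>A\<close> the inverse is the transpose, so
    \<open>Ad A\<close> coincides with \<open>congr_act A\<close>, which preserves symmetry.\<close>
  moreover have "Ad A \<xi> \<in> sym_mat" if "orthogonal_matrix A" "\<xi> \<in> sym_mat" for A \<xi> :: "'n mat"
  proof -
    have "matrix_inv A = transpose A"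
      using that(1) by (intro matrix_inv_eqI) (simp add: orthogonal_matrix_def)
    then show ?thesis
      using congr_act_sym[OF that(2), of A] by (simp add: Ad_def congr_act_def)
  qed
  moreover have "transpose (bracket \<xi> \<eta>) = - bracket \<xi> \<eta>" if "\<xi> \<in> sym_mat" "\<eta> \<in> sym_mat" for \<xi> \<eta> :: "'n mat"
    using that by (simp add: bracket_def sym_mat_def transpose_linear_simps matrix_transpose_mul)
  ultimately show ?thesis
    unfolding symmetric_reductive_structure_def reductive_structure_def Let_def isotropy_mat_1
      Lie_algebra_orthogonal Lie_algebra_GL
    by (auto simp: subspace_sym_mat)
qed

section \<open>The infinitesimal action and the connection form\<close>

lemma inf_act_GL:
  fixes \<xi> P :: "'n::finite mat"
  shows "inf_act GL congr_act \<xi> P = \<xi> ** P + P ** transpose \<xi>"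
  unfolding inf_act_def
proof (rule tangent_map_eqI)
  show "\<xi> \<in> tangent_space GL (mat 1)"
    using Lie_algebra_GL by (auto simp: Lie_algebra_def)
  fix \<gamma> assume "smooth_curve_at GL (mat 1) \<xi> \<gamma>"
  then have \<gamma>: "\<gamma> 0 = mat 1" "(\<gamma> has_vector_derivative \<xi>) (at 0)"
    by (auto simp: smooth_curve_at_def)
  have "((\<lambda>t. \<gamma> t ** P ** transpose (\<gamma> t)) has_vector_derivative
      \<gamma> 0 ** P ** transpose \<xi> + \<xi> ** P ** transpose (\<gamma> 0)) (at 0)"
    by (intro bounded_bilinear.has_vector_derivative[OF bounded_bilinear_matrix_mult]
        bounded_linear.has_vector_derivative[OF bounded_linear_transpose] \<gamma>
        bounded_linear.has_vector_derivative[OF bounded_bilinear.bounded_linear_left[OF bounded_bilinear_matrix_mult]])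
  then show "((\<lambda>g. congr_act g P) \<circ> \<gamma> has_vector_derivative \<xi> ** P + P ** transpose \<xi>) (at 0)"
    by (simp add: \<gamma> o_def congr_act_def add.commute)
qed

lemma tangent_map_congr_act:
  fixes P v :: "'n::finite mat"
  assumes "v \<in> tangent_space spd P"
  shows "tangent_map spd (congr_act A) P v = congr_act A v"
  by (rule tangent_map_linear[OF assms bounded_linear_congr_act])

definition sym_connection :: "'n::finite mat \<Rightarrow> 'n mat \<Rightarrow> 'n mat" where
  "sym_connection P v = (1/2) *\<^sub>R (v ** matrix_inv P)"

text \<open>Inverting \<open>congr_act A P\<close> puts the inverse of \<open>transpose A\<close>
  next to the \<open>transpose A\<close> coming from \<open>congr_act A v\<close>. They cancel, and
  what remains is conjugation by \<open>A\<close>.\<close>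

lemma sym_connection_equivariant:
  assumes "A \<in> GL" "P \<in> spd"
  shows "sym_connection (congr_act A P) (congr_act A v) = Ad A (sym_connection P v)"
proof -
  have A: "invertible A" "invertible (transpose A)" and P: "invertible P"
    using assms by (auto simp: GL_def transpose_invertible spd_invertible)
  have "congr_act A v ** matrix_inv (congr_act A P)
      = A ** v ** (transpose A ** matrix_inv (transpose A)) ** matrix_inv P ** matrix_inv A"
    using A P by (simp add: congr_act_def matrix_inv_mult invertible_mult matrix_mul_assoc)
  then show ?thesis
    using A by (simp add: sym_connection_def Ad_def matrix_inv_right matrix_mul_assoc matrix_mult_bilinear_simps)
qed

text \<open>Stated for every \<open>\<omega>\<close> that agrees with the formula on tangent
  vectors, since this is all that determines a connection. The formula itself, linear in
  \<open>v\<close> and smooth on the open set \<open>GL\<close>, is the local extension required of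
  a smooth one-form.\<close>

lemma connection_sym_connection:
  assumes \<omega>: "\<And>P v. P \<in> spd \<Longrightarrow> v \<in> tangent_space spd P \<Longrightarrow> \<omega> P v = sym_connection P v"
  shows "connection (GL :: 'n::finite mat set) congr_act spd \<omega>"
  unfolding connection_def smooth_one_form_def
proof (intro conjI ballI)
  fix P v :: "'n mat" assume P: "P \<in> spd" and v: "v \<in> tangent_space spd P"
  show "\<omega> P v \<in> Lie_algebra GL" by (simp add: Lie_algebra_GL)
  have inv: "invertible P" using P by (rule spd_invertible)
  have "transpose (matrix_inv P) = matrix_inv P" "transpose v = v"
    using inv P v by (auto simp: tangent_space_spd sym_mat_def spd_sym simp flip: matrix_inv_transpose)
  \<comment> \<open>As \<open>v\<close> and \<open>P\<close> are symmetric, both terms of the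
    infinitesimal action equal half of \<open>v\<close>; this is the origin of the factor
    1/2.\<close>
  then have "inf_act GL congr_act (sym_connection P v) P =
      (1/2) *\<^sub>R (v ** (matrix_inv P ** P)) + (1/2) *\<^sub>R (P ** matrix_inv P ** v)"
    by (simp add: inf_act_GL sym_connection_def transpose_scalar matrix_transpose_mul
        matrix_mult_bilinear_simps matrix_mul_assoc)
  also have "\<dots> = v"
    by (simp add: matrix_inv_left[OF inv] matrix_inv_right[OF inv] flip: scaleR_add_left)
  finally show "inf_act GL congr_act (\<omega> P v) P = v" using \<omega>[OF P v] by simp
next
  fix A P v :: "'n mat" assume A: "A \<in> GL" and P: "P \<in> spd" and v: "v \<in> tangent_space spd P"
  have "congr_act A v \<in> tangent_space spd (congr_act A P)"
    using v P A by (simp add: tangent_space_spd congr_act_spd congr_act_sym)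
  then show "\<omega> (congr_act A P) (tangent_map spd (congr_act A) P v) = Ad A (\<omega> P v)"
    using sym_connection_equivariant[OF A P] \<omega> v P congr_act_spd[OF A P]
    by (simp add: tangent_map_congr_act)
next
  fix P :: "'n mat" assume P: "P \<in> spd"
  show "\<exists>U W. open U \<and> P \<in> U \<and> (\<forall>Q\<in>U. linear (W Q)) \<and> (\<forall>v. Cinf_on U (\<lambda>Q. W Q v)) \<and>
      (\<forall>Q\<in>U \<inter> spd. \<forall>v\<in>tangent_space spd Q. \<omega> Q v = W Q v)"
  proof (intro exI conjI ballI allI)
    show "open (GL :: 'n mat set)" by (rule open_GL)
    show "P \<in> GL" using P by (simp add: GL_def spd_invertible)
    show "linear (sym_connection Q)" for Q :: "'n mat"
      unfolding linear_iff sym_connection_def by (simp add: matrix_mult_bilinear_simps scaleR_add_right)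
    show "Cinf_on GL (\<lambda>Q :: 'n mat. sym_connection Q v)" for v
      unfolding sym_connection_def
      by (intro Cinf_on_bounded_linear[OF _ bounded_linear_scaleR_right] Cinf_on_matrix_inv Cinf_on_linear
          Cinf_on_bounded_linear[OF _ bounded_bilinear.bounded_linear_right[OF bounded_bilinear_matrix_mult]]
          open_GL bounded_linear_ident) (simp add: GL_def)
    show "\<omega> Q v = sym_connection Q v" if "Q \<in> GL \<inter> spd" "v \<in> tangent_space spd Q" for Q v
      using that \<omega> by blast
  qed
qed

lemma sym_connection_image:
  assumes \<omega>: "\<And>v. v \<in> tangent_space spd (mat 1) \<Longrightarrow> \<omega> (mat 1) v = sym_connection (mat 1) v"
  shows "\<omega> (mat 1) ` tangent_space spd (mat 1) = (sym_mat :: 'n::finite mat set)"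
proof -
  have "\<omega> (mat 1) ` tangent_space spd (mat 1) = (\<lambda>v. (1/2) *\<^sub>R v) ` (sym_mat :: 'n mat set)"
    using \<omega> by (intro image_cong) (simp_all add: tangent_space_spd mat_1_in_spd sym_connection_def)
  also have "\<dots> = sym_mat"
  proof (intro set_eqI iffI)
    fix \<xi> :: "'n mat" assume "\<xi> \<in> sym_mat"
    then have "\<xi> = (1/2) *\<^sub>R (2 *\<^sub>R \<xi>)" "2 *\<^sub>R \<xi> \<in> sym_mat"
      by (simp_all add: subspace_scale[OF subspace_sym_mat])
    then show "\<xi> \<in> (\<lambda>v. (1/2) *\<^sub>R v) ` sym_mat" by (rule image_eqI)
  qed (auto simp: subspace_scale[OF subspace_sym_mat])
  finally show ?thesis .
qed

lemma corresponding_connection_unique: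
  assumes \<omega>: "corresponding_connection GL congr_act spd (mat 1) (sym_mat :: 'n::finite mat set) \<omega>"
    and P: "P \<in> spd" and v: "v \<in> tangent_space spd P"
  shows "\<omega> P v = sym_connection P v"
proof -
  obtain A where A: "A \<in> GL" "congr_act A (mat 1) = P"
    using spd_eq_congr_act_mat_1[OF P] .
  \<comment> \<open>Pulls \<open>v\<close> back to the identity, where the image condition on
    \<open>\<omega>\<close> applies.\<close>
  define u where "u = congr_act (matrix_inv A) v"
  have u: "u \<in> tangent_space spd (mat 1)" and v_eq: "v = congr_act A u"
    using v P congr_act_inv_cancel(2)[OF A(1)]
    by (simp_all add: u_def tangent_space_spd mat_1_in_spd congr_act_sym)
  have "\<omega> (mat 1) u \<in> sym_mat"
    using \<omega> u by (auto simp: corresponding_connection_def)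
  moreover have "inf_act GL congr_act (\<omega> (mat 1) u) (mat 1) = u"
    using \<omega> u mat_1_in_spd by (auto simp: corresponding_connection_def connection_def)
  \<comment> \<open>For symmetric \<open>\<xi>\<close> the infinitesimal action at the identity,
    \<open>\<xi> + transpose \<xi>\<close>, is just doubling.\<close>
  ultimately have "u = 2 *\<^sub>R \<omega> (mat 1) u"
    by (simp add: inf_act_GL sym_mat_def scaleR_2)
  then have "\<omega> (mat 1) u = sym_connection (mat 1) u"
    unfolding sym_connection_def by (metis divide_self_if matrix_inv_mat_1 matrix_mul_rid mult.commute
        nonzero_divide_eq_eq scaleR_one scaleR_scaleR zero_neq_numeral)
  moreover have "\<omega> P v = Ad A (\<omega> (mat 1) u)"
    using \<omega> u A mat_1_in_spd tangent_map_congr_act[OF u, of A]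
    unfolding v_eq corresponding_connection_def connection_def by metis
  ultimately show ?thesis
    using sym_connection_equivariant[OF A(1) mat_1_in_spd, of u] A(2) v_eq by simp
qed

text \<open>The closing equivalence carries both halves of "the corresponding connection": its
  forward direction is uniqueness, its backward direction existence.\<close>

theorem proposition5p6:
  shows "homogeneous_space (GL :: 'n::finite mat set) congr_act (spd :: 'n mat set) \<and>
    isotropy (GL :: 'n mat set) congr_act (mat 1 :: 'n mat) = {A. orthogonal_matrix A} \<and>
    symmetric_reductive_structure (GL :: 'n mat set) congr_act (mat 1 :: 'n mat) sym_mat \<and>
    symmetric_connection (GL :: 'n mat set) congr_act (spd :: 'n mat set) (mat 1)
      (\<lambda>P \<delta>P. (1/2) *\<^sub>R (\<delta>P ** matrix_inv P)) \<and>
    (\<forall>\<omega>. corresponding_connection (GL :: 'n mat set) congr_act (spd :: 'n mat set) (mat 1) sym_mat \<omega>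
      \<longleftrightarrow> (\<forall>P\<in>spd. \<forall>\<delta>P\<in>tangent_space spd P.
              \<omega> P \<delta>P = (1/2) *\<^sub>R (\<delta>P ** matrix_inv P)))"
proof (intro conjI allI iffI ballI)
  show "homogeneous_space (GL :: 'n mat set) congr_act spd"
    by (rule homogeneous_space_spd)
  show "isotropy GL congr_act (mat 1) = {A :: 'n mat. orthogonal_matrix A}"
    by (rule isotropy_mat_1)
  show "symmetric_reductive_structure GL congr_act (mat 1) (sym_mat :: 'n mat set)"
    by (rule symmetric_reductive_structure_sym_mat)
  show "symmetric_connection (GL :: 'n mat set) congr_act spd (mat 1)
      (\<lambda>P \<delta>P. (1/2) *\<^sub>R (\<delta>P ** matrix_inv P))"
    unfolding symmetric_connection_def sym_connection_def[symmetric]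
    by (simp add: connection_sym_connection sym_connection_image symmetric_reductive_structure_sym_mat)
next
  fix \<omega> and P v :: "'n mat"
  assume "corresponding_connection GL congr_act spd (mat 1) (sym_mat :: 'n mat set) \<omega>"
    and "P \<in> spd" and "v \<in> tangent_space spd P"
  from corresponding_connection_unique[OF this]
  show "\<omega> P v = (1/2) *\<^sub>R (v ** matrix_inv P)" unfolding sym_connection_def .
next
  fix \<omega> :: "'n mat \<Rightarrow> 'n mat \<Rightarrow> 'n mat"
  assume "\<forall>P\<in>spd. \<forall>\<delta>P\<in>tangent_space spd P. \<omega> P \<delta>P = (1/2) *\<^sub>R (\<delta>P ** matrix_inv P)"
  then have "\<omega> P v = sym_connection P v" if "P \<in> spd" "v \<in> tangent_space spd P" for P v
    using that by (simp add: sym_connection_def)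
  then show "corresponding_connection GL congr_act spd (mat 1) sym_mat \<omega>"
    unfolding corresponding_connection_def
    by (simp add: connection_sym_connection sym_connection_image mat_1_in_spd)
qed

end
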